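(* Let $\alpha>0$, $\eta>0$, $\beta>0$, let $X,Y\subset\mathbb{R}^d$ be two domains with $\max\{\operatorname{diam}X,\operatorname{diam}Y\}\le\eta\,\operatorname{dist}(X,Y)$, where $X$ is a cube or, more generally, a union of rotations and translations of a fixed cube of positive side length, and let $f(x,y)=|x-y|^{-\alpha}$ for $x\in X$, $y\in Y$. Let $c_M>1$ be a constant. Then there are constants $c>0$ and $0<\lambda<1$, independent of $k$ and of the chosen points, such that the following holds. Let $k\in\mathbb{N}$, let $x_1,\dots,x_k\in X$ and $y_1,\dots,y_k\in Y$ be pivots for which the cross approximation remainder $r_k$ is defined, and suppose that $y_1,\dots,y_k$ are chosen such that $$|\det C_k^{(i)}(y)|\le c_M\,|\det C_k|,\qquad 1\le i\le k,\ y\in Y.$$ Then, with $X_k:=\{x_1,\dots,x_k\}$, $$|r_k(x,y)|\le c\,(c_M k+1)\,\lambda^{1/h_{X_k,X}}\qquad\text{for all }x\in X,\ y\in Y.$$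
   Context: Cross approximation: set $r_0:=f$ and, for pivots $x_{j}\in X$, $y_{j}\in Y$ with $r_{j-1}(x_{j},y_{j})\ne0$ ($j=1,\dots,k$), $$r_{j}(x,y):=r_{j-1}(x,y)-\frac{r_{j-1}(x_{j},y)}{r_{j-1}(x_{j},y_{j})}\,r_{j-1}(x,y_{j}).$$ $C_k\in\mathbb{R}^{k\times k}$ is the matrix with entries $(C_k)_{ij}=f(x_i,y_j)$; its determinant equals $r_0(x_1,y_1)\cdots r_{k-1}(x_k,y_k)\neq0$. One has $r_k(x,y)=f(x,y)-v_k(x)^TC_k^{-1}w_k(y)$ with $v_k(x)=[f(x,y_1),\dots,f(x,y_k)]^T$ and $w_k(y)=[f(x_1,y),\dots,f(x_k,y)]^T$. For $y\in Y$, $C_k^{(i)}(y)$ denotes the matrix obtained from $C_k$ by replacing its $i$-th column with $w_k(y)$. Fill distance: $h_{X_k,X}:=\sup_{x\in X}\operatorname{dist}(x,X_k)$. In the paper the setting also includes the Gaussian $\kappa(x)=\exp(-\beta|x|^2)$ and, for $y\in Y$, the radial basis function interpolant $p_y\in\operatorname{span}\{\kappa(\cdot-x_j):j=1,\dots,k\}$ of $f(\cdot,y)$ at $x_1,\dots,x_k$; these do not appear in the conclusion. *)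

theory Defs
  imports "HOL-Analysis.Analysis" "Jordan_Normal_Form.Determinant"
begin

(* HOL-Analysis and Jordan_Normal_Form share the names det, mat, vec; matrices whose size k
   varies are those of Jordan_Normal_Form, rotations of R^d are those of HOL-Analysis.
   Points are indexed from 0: xs i and ys i stand for x_(i+1) and y_(i+1). *)

definition f_kernel :: "real \<Rightarrow> real ^ 'd \<Rightarrow> real ^ 'd \<Rightarrow> real" where
  "f_kernel \<alpha> x y = norm (x - y) powr (- \<alpha>)"

(* The remainder r_k; the step from r_j to r_(j+1) uses the pivot (xs j, ys j). *)
fun cross_remainder ::
  "('a \<Rightarrow> 'b \<Rightarrow> real) \<Rightarrow> (nat \<Rightarrow> 'a) \<Rightarrow> (nat \<Rightarrow> 'b) \<Rightarrow> nat \<Rightarrow> 'a \<Rightarrow> 'b \<Rightarrow> real" where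
  "cross_remainder f xs ys 0 x y = f x y"
| "cross_remainder f xs ys (Suc j) x y =
     cross_remainder f xs ys j x y
     - cross_remainder f xs ys j (xs j) y / cross_remainder f xs ys j (xs j) (ys j)
       * cross_remainder f xs ys j x (ys j)"

definition admissible_pivots ::
  "('a \<Rightarrow> 'b \<Rightarrow> real) \<Rightarrow> 'a set \<Rightarrow> 'b set \<Rightarrow> (nat \<Rightarrow> 'a) \<Rightarrow> (nat \<Rightarrow> 'b) \<Rightarrow> nat \<Rightarrow> bool" where
  "admissible_pivots f X Y xs ys k \<longleftrightarrow>
     (\<forall>j<k. xs j \<in> X \<and> ys j \<in> Y \<and> cross_remainder f xs ys j (xs j) (ys j) \<noteq> 0)"

definition cross_matrix ::
  "('a \<Rightarrow> 'b \<Rightarrow> real) \<Rightarrow> (nat \<Rightarrow> 'a) \<Rightarrow> (nat \<Rightarrow> 'b) \<Rightarrow> nat \<Rightarrow> real Matrix.mat" where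
  "cross_matrix f xs ys k = Matrix.mat k k (\<lambda>(i, j). f (xs i) (ys j))"

definition cross_column ::
  "('a \<Rightarrow> 'b \<Rightarrow> real) \<Rightarrow> (nat \<Rightarrow> 'a) \<Rightarrow> nat \<Rightarrow> 'b \<Rightarrow> real Matrix.vec" where
  "cross_column f xs k y = Matrix.vec k (\<lambda>i. f (xs i) y)"

(* For S = {} the library convention gives 0 instead of infinity; both give 1 / h = 0. *)
definition fill_distance :: "'a::metric_space set \<Rightarrow> 'a set \<Rightarrow> real" where
  "fill_distance S X = (SUP x\<in>X. infdist x S)"

(* Axis-parallel cubes of positive side length; both the open and the closed one count. *)
definition is_cube :: "(real ^ 'd) set \<Rightarrow> bool" where
  "is_cube Q \<longleftrightarrow>
     (\<exists>a s. s > 0 \<and> (Q = cbox a (a + s *\<^sub>R One) \<or> Q = box a (a + s *\<^sub>R One)))"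

definition union_of_moved_cubes :: "(real ^ 'd) set \<Rightarrow> bool" where
  "union_of_moved_cubes X \<longleftrightarrow>
     (\<exists>Q M. is_cube Q \<and> (\<forall>(R, t)\<in>M. rotation_matrix R) \<and>
            X = (\<Union>(R, t)\<in>M. (\<lambda>z. R *v z + t) ` Q))"

lemma union_of_moved_cubes_cube:
  assumes "is_cube Q" "rotation_matrix R"
  shows "union_of_moved_cubes ((\<lambda>z. R *v z + t) ` Q)"
  unfolding union_of_moved_cubes_def
  by (rule exI[of _ Q], rule exI[of _ "{(R, t)}"]) (use assms in auto)

lemma is_cube_imp_union_of_moved_cubes:
  assumes "is_cube Q"
  shows "union_of_moved_cubes Q"
proof -
  have "rotation_matrix (Finite_Cartesian_Product.mat 1 :: real ^ 'd ^ 'd)"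
    by (simp add: rotation_matrix_def orthogonal_matrix_id)
  from union_of_moved_cubes_cube[OF assms this, of 0] show ?thesis by simp
qed

end

theory Submission
  imports Defs "HOL-Complex_Analysis.Conformal_Mappings"
begin

text \<open>By Cramer's rule \<open>r\<^sub>k(\<cdot>, y)\<close> is a combination of \<open>f(\<cdot>, y)\<close> and the \<open>f(\<cdot>, y\<^sub>i)\<close> with coefficients
  bounded by \<open>c\<^sub>M\<close>, and it vanishes at the pivots \<open>x\<^sub>j\<close>. On a ball of small radius \<open>\<delta>\<close> the binomial
  series approximates it by a polynomial of degree \<open>2 n\<close> up to an error \<open>(const * \<delta>) ^ n\<close>.
  A polynomial \<open>P\<close> of degree \<open>N\<close> that is small on a set which is \<open>const * \<delta> / N\<close>-dense in a ball is small
  on a concentric ball: the maximum of \<open>(\<delta>\<^sup>2 - |x|\<^sup>2) ^ (10 * N) * |P x|\<close> is attained well inside, and on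
  the chord from there to a nearby point of the set Bernstein's inequality shows that it hardly
  changes. Extrapolating from the ball to points of \<open>X\<close> at distance \<open>O(\<delta>)\<close> costs a factor
  \<open>const ^ N\<close>, which a small \<open>\<delta>\<close> compensates. With \<open>n\<close> proportional to \<open>1 / h\<close> this is the
  estimate.\<close>


section \<open>Growth and Bernstein inequalities for polynomials in one variable\<close>

lemma poly_eq_sum_le:
  fixes p :: "'a::comm_semiring_1 poly"
  assumes "degree p \<le> N"
  shows "poly p x = (\<Sum>i\<le>N. coeff p i * x ^ i)"
  unfolding poly_altdef
  by (rule sum.mono_neutral_left) (use assms in \<open>auto simp: coeff_eq_0\<close>)

text \<open>The reversed polynomial \<open>q\<close> satisfies
  \<open>poly p u = u ^ N * q (1 / u)\<close> and has the same modulus as \<open>p\<close> at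
  reciprocal points of the unit circle, so the maximum principle inside the disk controls
  \<open>p\<close> outside it.\<close>

lemma poly_bound_outside_disk:
  fixes p :: "complex poly"
  assumes deg: "degree p \<le> N" and bnd: "\<And>z. norm z = 1 \<Longrightarrow> norm (poly p z) \<le> A"
    and z: "norm z \<ge> 1"
  shows "norm (poly p z) \<le> A * norm z ^ N"
proof -
  define q where "q = (\<lambda>w. \<Sum>i\<le>N. coeff p i * w ^ (N - i))"
  have pq: "poly p u = u ^ N * q (1 / u)" if "u \<noteq> 0" for u
  proof -
    have "poly p u = (\<Sum>i\<le>N. coeff p i * u ^ i)"
      by (rule poly_eq_sum_le[OF deg])
    also have "\<dots> = (\<Sum>i\<le>N. u ^ N * (coeff p i * (1 / u) ^ (N - i)))"
    proof (rule sum.cong)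
      fix i assume "i \<in> {..N}"
      then have "u ^ N = u ^ i * u ^ (N - i)" by (simp flip: power_add)
      with that show "coeff p i * u ^ i = u ^ N * (coeff p i * (1 / u) ^ (N - i))"
        by (simp add: power_divide)
    qed simp
    finally show ?thesis by (simp add: q_def sum_distrib_left)
  qed
  have circle: "norm (q w) \<le> A" if "norm w = 1" for w
    using pq[of "1 / w"] bnd[of "1 / w"] that
    by (cases "w = 0") (auto simp: norm_divide norm_mult norm_power power_divide)
  have "norm (q (1 / z)) \<le> A"
    by (rule maximum_modulus_frontier[where S = "cball 0 1"])
      (use z circle in \<open>auto simp: q_def norm_divide divide_le_eq intro!: holomorphic_intros continuous_intros\<close>)
  moreover have "norm (poly p z) = norm z ^ N * norm (q (1 / z))"
    using pq[of z] z by (cases "z = 0") (auto simp: norm_mult norm_power)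
  ultimately show ?thesis
    by (simp add: mult.commute[of A] mult_left_mono)
qed

lemma poly_bound_inside_disk:
  fixes p :: "complex poly"
  assumes bnd: "\<And>z. norm z = 1 \<Longrightarrow> norm (poly p z) \<le> A" and z: "norm z \<le> 1"
  shows "norm (poly p z) \<le> A"
  by (rule maximum_modulus_frontier[where S = "cball 0 1"])
    (use z bnd in \<open>auto intro!: holomorphic_intros continuous_intros\<close>)

text \<open>A weak form of Bernstein's inequality: the derivative is estimated by Cauchy's inequality on
  circles of radius \<open>1 / N\<close>, where the polynomial is at most \<open>(1 + 1 / N) ^ N \<le> 3\<close> times larger.\<close>

lemma poly_lipschitz_disk:
  fixes p :: "complex poly"
  assumes deg: "degree p \<le> N" and N: "N \<ge> 1"
    and bnd: "\<And>z. norm z = 1 \<Longrightarrow> norm (poly p z) \<le> A"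
    and a: "norm a \<le> 1" and b: "norm b \<le> 1"
  shows "norm (poly p a - poly p b) \<le> 3 * real N * A * norm (a - b)"
proof -
  have A: "A \<ge> 0" using order_trans[OF norm_ge_zero bnd[of 1]] by simp
  have "(1 + 1 / real N) ^ N \<le> exp (1 / real N) ^ N"
    by (rule power_mono) (auto intro: exp_ge_add_one_self)
  also have "\<dots> = exp (real N * (1 / real N))" by (simp only: exp_of_nat_mult)
  also have "\<dots> = exp 1" using N by simp
  also have "\<dots> \<le> 3" by (rule exp_le)
  finally have e: "(1 + 1 / real N) ^ N \<le> 3" .
  have near: "norm (poly p w) \<le> 3 * A" if "norm w \<le> 1 + 1 / real N" for w
  proof (cases "norm w \<le> 1")
    case True
    then have "norm (poly p w) \<le> A" by (rule poly_bound_inside_disk[OF bnd, rotated])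
    with A show ?thesis by simp
  next
    case False
    then have "norm (poly p w) \<le> A * norm w ^ N"
      by (intro poly_bound_outside_disk[OF deg bnd]) auto
    also have "\<dots> \<le> A * (1 + 1 / real N) ^ N"
      by (intro mult_left_mono power_mono that A) auto
    also have "\<dots> \<le> A * 3" by (intro mult_left_mono e A)
    finally show ?thesis by simp
  qed
  show ?thesis
  proof (rule field_differentiable_bound[where S = "cball 0 1" and f' = "deriv (poly p)"])
    fix z :: complex assume z: "z \<in> cball 0 1"
    show "(poly p has_field_derivative deriv (poly p) z) (at z within cball 0 1)"
      by (metis DERIV_imp_deriv has_field_derivative_at_within poly_DERIV)
    have "norm ((deriv ^^ 1) (poly p) z) \<le> fact 1 * (3 * A) / (1 / real N) ^ 1"
    proof (rule Cauchy_inequality)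
      fix w assume w: "norm (z - w) = 1 / real N"
      have "norm w \<le> norm z + norm (z - w)" by (metis norm_triangle_sub norm_minus_commute add.commute)
      with z w show "norm (poly p w) \<le> 3 * A" by (intro near) auto
    qed (use N in \<open>auto intro!: holomorphic_intros continuous_intros\<close>)
    then show "norm (deriv (poly p) z) \<le> 3 * real N * A" by (simp add: mult_ac)
  qed (use a b in auto)
qed

text \<open>This is \<open>w ^ D * q ((w + 1 / w) / 2)\<close> with denominators cleared. The
  Joukowski map turns questions about \<open>q\<close> on [-1, 1] into questions about a polynomial
  on the unit circle, at the price of doubling the degree.\<close>

definition joukowski_poly :: "nat \<Rightarrow> real poly \<Rightarrow> complex poly" where
  "joukowski_poly D q =
     (\<Sum>j\<le>D. Polynomial.smult (of_real (coeff q j) / 2 ^ j) ([:1, 0, 1:] ^ j * [:0, 1:] ^ (D - j)))"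

lemma degree_joukowski_poly: "degree (joukowski_poly D q) \<le> 2 * D"
  unfolding joukowski_poly_def
proof (rule degree_sum_le)
  fix j assume "j \<in> {..D}"
  have "degree ([:1, 0, 1:] ^ j * [:0, 1:] ^ (D - j) :: complex poly)
      \<le> degree ([:1, 0, 1::complex:] ^ j) + degree ([:0, 1::complex:] ^ (D - j))"
    by (rule degree_mult_le)
  also have "\<dots> \<le> 2 * j + (D - j)"
    by (intro add_mono order_trans[OF degree_power_le]) auto
  also have "\<dots> \<le> 2 * D" using \<open>j \<in> {..D}\<close> by simp
  finally show "degree (Polynomial.smult (of_real (coeff q j) / 2 ^ j)
      ([:1, 0, 1:] ^ j * [:0, 1:] ^ (D - j)) :: complex poly) \<le> 2 * D"
    using degree_smult_le order_trans by blast
qed simp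

text \<open>Since \<open>1 + w * w = 2 * w * t\<close>, the summand of index j becomes
  \<open>w ^ D\<close> times the j-th term of \<open>poly q t\<close>.\<close>

lemma poly_joukowski_poly:
  fixes w :: complex and t :: real
  assumes deg: "degree q \<le> D" and w: "w \<noteq> 0" and t: "(w + 1 / w) / 2 = of_real t"
  shows "norm (poly (joukowski_poly D q) w) = norm w ^ D * \<bar>poly q t\<bar>"
proof -
  have w2: "1 + w * w = 2 * w * of_real t"
    using t w by (simp add: field_simps)
  have "poly (joukowski_poly D q) w
      = (\<Sum>j\<le>D. of_real (coeff q j) / 2 ^ j * ((1 + w * w) ^ j * w ^ (D - j)))"
    by (simp add: joukowski_poly_def poly_sum)
  also have "\<dots> = (\<Sum>j\<le>D. w ^ D * of_real (coeff q j * t ^ j))"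
  proof (rule sum.cong)
    fix j assume "j \<in> {..D}"
    then have "w ^ D = w ^ j * w ^ (D - j)" by (simp flip: power_add)
    then show "of_real (coeff q j) / 2 ^ j * ((1 + w * w) ^ j * w ^ (D - j))
        = w ^ D * of_real (coeff q j * t ^ j)"
      by (simp add: w2 power_mult_distrib)
  qed simp
  also have "\<dots> = w ^ D * of_real (poly q t)"
    by (simp add: poly_eq_sum_le[OF deg] sum_distrib_left)
  finally show ?thesis by (simp add: norm_mult norm_power)
qed

text \<open>On the unit circle \<open>1 / w\<close> is the conjugate of \<open>w\<close>, so the
  Joukowski map takes \<open>w\<close> to its real part, a point of [-1, 1].\<close>

lemma joukowski_poly_bound_circle:
  assumes deg: "degree q \<le> D" and bnd: "\<And>s. \<bar>s\<bar> \<le> 1 \<Longrightarrow> \<bar>poly q s\<bar> \<le> A"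
    and w: "norm w = 1"
  shows "norm (poly (joukowski_poly D q) w) \<le> A"
proof -
  have "w * cnj w = 1" using w by (metis complex_norm_square of_real_1 one_power2)
  then have "1 / w = cnj w" by (metis div_by_1 divide_eq_eq mult.commute mult_zero_left zero_neq_one)
  then have "(w + 1 / w) / 2 = of_real (Re w)" by (simp add: complex_add_cnj)
  moreover have "\<bar>Re w\<bar> \<le> 1" using abs_Re_le_cmod[of w] w by simp
  ultimately show ?thesis
    using poly_joukowski_poly[OF deg, of w "Re w"] w bnd[of "Re w"] by (cases "w = 0") auto
qed

text \<open>A Bernstein-Walsh estimate: a Joukowski preimage \<open>v\<close> of \<open>t\<close>
  lies outside the open unit disk and \<open>\<bar>v\<bar> \<le> 2 * \<bar>t\<bar>\<close>. The disk
  estimate gives \<open>\<bar>v\<bar> ^ (2 * D)\<close>, half of which cancels against the factor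
  \<open>\<bar>v\<bar> ^ D\<close> of the lifted polynomial.\<close>

lemma poly_bound_outside_interval:
  fixes q :: "real poly"
  assumes deg: "degree q \<le> D" and bnd: "\<And>s. \<bar>s\<bar> \<le> 1 \<Longrightarrow> \<bar>poly q s\<bar> \<le> A"
    and t: "\<bar>t\<bar> \<ge> 1"
  shows "\<bar>poly q t\<bar> \<le> A * (2 * \<bar>t\<bar>) ^ D"
proof -
  have A: "A \<ge> 0" using bnd[of 0] by simp
  define r where "r = sqrt (t\<^sup>2 - 1)"
  \<comment> \<open>The root of largest modulus of \<open>v * v - 2 * t * v + 1 = 0\<close>.\<close>
  define v where "v = t + sgn t * r"
  have t1: "t\<^sup>2 \<ge> 1" using t by (metis abs_le_square_iff abs_one one_power2)
  then have r: "r \<ge> 0" "r * r = t * t - 1" by (simp_all add: r_def flip: power2_eq_square)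
  have vt: "\<bar>v\<bar> = \<bar>t\<bar> + r"
    using t r(1) by (cases "t > 0") (auto simp: v_def sgn_if)
  have "r \<le> \<bar>t\<bar>" unfolding r_def by (rule real_le_lsqrt) auto
  with vt t r(1) have v: "\<bar>v\<bar> \<ge> 1" "\<bar>v\<bar> \<le> 2 * \<bar>t\<bar>" by auto
  have "sgn t * sgn t = 1" using t by (auto simp: sgn_if)
  moreover have "v * v = t * t + 2 * t * (sgn t * r) + (sgn t * sgn t) * (r * r)"
    by (simp add: v_def algebra_simps)
  ultimately have "v * v + 1 = 2 * t * v"
    using r(2) by (simp add: v_def algebra_simps)
  then have "(v + 1 / v) / 2 = t" using v by (auto simp: field_simps)
  then have vt': "(complex_of_real v + 1 / of_real v) / 2 = of_real t"
    by (metis of_real_add of_real_divide of_real_1 of_real_numeral)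
  have "\<bar>v\<bar> ^ D * \<bar>poly q t\<bar> = norm (poly (joukowski_poly D q) (of_real v))"
    using poly_joukowski_poly[OF deg _ vt'] v by auto
  also have "\<dots> \<le> A * norm (complex_of_real v) ^ (2 * D)"
    using v by (intro poly_bound_outside_disk degree_joukowski_poly joukowski_poly_bound_circle[OF deg bnd]) auto
  also have "\<dots> = \<bar>v\<bar> ^ D * (A * \<bar>v\<bar> ^ D)" by (simp add: power_add mult_2)
  finally have "\<bar>poly q t\<bar> \<le> A * \<bar>v\<bar> ^ D" using v by (simp add: mult_le_cancel_left)
  also have "\<dots> \<le> A * (2 * \<bar>t\<bar>) ^ D" using v A by (intro mult_left_mono power_mono) auto
  finally show ?thesis .
qed

text \<open>The points are lifted to the upper unit semicircle, where the estimate on the disk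
  applies in degree \<open>2 * D\<close>. Away from the endpoints of [-1, 1] the lift has Lipschitz
  constant 4, and 3 * 2 * 4 = 24.\<close>

lemma poly_lipschitz_interval:
  fixes q :: "real poly"
  assumes deg: "degree q \<le> D" and D: "D \<ge> 1" and bnd: "\<And>s. \<bar>s\<bar> \<le> 1 \<Longrightarrow> \<bar>poly q s\<bar> \<le> A"
    and a: "\<bar>a\<bar> \<le> 9 / 10" and b: "\<bar>b\<bar> \<le> 9 / 10"
  shows "\<bar>\<bar>poly q a\<bar> - \<bar>poly q b\<bar>\<bar> \<le> 24 * real D * A * \<bar>a - b\<bar>"
proof -
  have A: "A \<ge> 0" using bnd[of 0] by simp
  define w where "w s = Complex s (sqrt (1 - s\<^sup>2))" for s
  have sq: "s\<^sup>2 \<le> 81 / 100" if "\<bar>s\<bar> \<le> 9 / 10" for s :: real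
    using power_mono[OF that, of 2] by (simp add: power_divide)
  have nw: "norm (w s) = 1" if "\<bar>s\<bar> \<le> 9 / 10" for s
    using sq[OF that] by (simp add: w_def cmod_def)
  have qw: "norm (poly (joukowski_poly D q) (w s)) = \<bar>poly q s\<bar>" if "\<bar>s\<bar> \<le> 9 / 10" for s
  proof -
    have "w s * cnj (w s) = 1" using nw[OF that] by (metis complex_norm_square of_real_1 one_power2)
    then have "1 / w s = cnj (w s)"
      by (metis div_by_1 divide_eq_eq mult.commute mult_zero_left zero_neq_one)
    then have "(w s + 1 / w s) / 2 = of_real s"
      by (simp add: complex_add_cnj w_def)
    then show ?thesis
      using poly_joukowski_poly[OF deg, of "w s" s] nw[OF that] by (cases "w s = 0") auto
  qed
  have root: "sqrt (1 - s\<^sup>2) \<ge> 3 / 10" if "\<bar>s\<bar> \<le> 9 / 10" for s :: real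
    by (rule real_le_rsqrt) (use sq[OF that] in \<open>simp add: power_divide\<close>)
  \<comment> \<open>The difference of the roots times their sum is, up to sign,
    \<open>(a - b) * (a + b)\<close>. The sum is at least 6/10 and \<open>\<bar>a + b\<bar>\<close>
    at most 18/10.\<close>
  have "\<bar>sqrt (1 - a\<^sup>2) - sqrt (1 - b\<^sup>2)\<bar> \<le> 3 * \<bar>a - b\<bar>"
  proof -
    let ?u = "sqrt (1 - a\<^sup>2)" and ?v = "sqrt (1 - b\<^sup>2)"
    have "?u\<^sup>2 = 1 - a\<^sup>2" "?v\<^sup>2 = 1 - b\<^sup>2" using sq[OF a] sq[OF b] by auto
    then have "(?u - ?v) * (?u + ?v) = (b - a) * (a + b)"
      by (simp add: power2_eq_square algebra_simps del: real_sqrt_mult_self real_sqrt_pow2_iff)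
    then have "\<bar>?u - ?v\<bar> * (?u + ?v) = \<bar>a - b\<bar> * \<bar>a + b\<bar>"
      using root[OF a] root[OF b] by (metis abs_minus_commute abs_mult abs_of_nonneg add_nonneg_nonneg
          order_trans[of 0 "3/10::real"] zero_le_divide_iff zero_le_numeral)
    also have "\<dots> \<le> \<bar>a - b\<bar> * (18 / 10)" using abs_triangle_ineq[of a b] a b by (intro mult_left_mono) auto
    finally have 1: "\<bar>?u - ?v\<bar> * (?u + ?v) \<le> \<bar>a - b\<bar> * (18 / 10)" .
    have "\<bar>?u - ?v\<bar> * (6 / 10) \<le> \<bar>?u - ?v\<bar> * (?u + ?v)"
      using root[OF a] root[OF b] by (intro mult_left_mono) auto
    with 1 show ?thesis by simp
  qed
  then have "norm (w a - w b) \<le> 4 * \<bar>a - b\<bar>"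
    using cmod_le[of "w a - w b"] by (simp add: w_def)
  then have "3 * real (2 * D) * A * norm (w a - w b) \<le> 3 * real (2 * D) * A * (4 * \<bar>a - b\<bar>)"
    using A by (intro mult_left_mono) auto
  moreover have "norm (poly (joukowski_poly D q) (w a) - poly (joukowski_poly D q) (w b))
      \<le> 3 * real (2 * D) * A * norm (w a - w b)"
    using D nw[OF a] nw[OF b]
    by (intro poly_lipschitz_disk degree_joukowski_poly joukowski_poly_bound_circle[OF deg bnd]) auto
  moreover have "\<bar>\<bar>poly q a\<bar> - \<bar>poly q b\<bar>\<bar>
      \<le> norm (poly (joukowski_poly D q) (w a) - poly (joukowski_poly D q) (w b))"
    using norm_triangle_ineq3[of "poly (joukowski_poly D q) (w a)" "poly (joukowski_poly D q) (w b)"]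
    by (simp add: qw[OF a] qw[OF b])
  ultimately show ?thesis by (simp add: algebra_simps)
qed


section \<open>Polynomials in several variables that are small on a dense set\<close>

text \<open>Every estimate restricts the function to a line and uses a one-variable inequality
  there, so a degree bound that is uniform over all lines is the only algebraic information
  kept.\<close>

definition polynomial_on_lines :: "nat \<Rightarrow> ('a::real_vector \<Rightarrow> real) \<Rightarrow> bool" where
  "polynomial_on_lines N P \<longleftrightarrow>
     (\<forall>a b. \<exists>p. degree p \<le> N \<and> (\<forall>t. poly p t = P (a + t *\<^sub>R b)))"

lemma polynomial_on_lines_extrapolate:
  fixes P :: "'a::euclidean_space \<Rightarrow> real"
  assumes P: "polynomial_on_lines N P" and r: "r > 0"
    and bnd: "\<And>x. norm x \<le> r \<Longrightarrow> \<bar>P x\<bar> \<le> B" and x: "norm x \<ge> r"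
  shows "\<bar>P x\<bar> \<le> B * (2 * (norm x / r)) ^ N"
proof -
  define b where "b = (r / norm x) *\<^sub>R x"
  have x0: "norm x > 0" using x r by linarith
  then have nb: "norm b = r" using r by (simp add: b_def)
  have xb: "x = (norm x / r) *\<^sub>R b" using x0 r by (simp add: b_def)
  obtain p where p: "degree p \<le> N" "\<And>t. poly p t = P (0 + t *\<^sub>R b)"
    using P unfolding polynomial_on_lines_def by metis
  have "\<bar>poly p s\<bar> \<le> B" if "\<bar>s\<bar> \<le> 1" for s
    using that r by (simp add: p(2) nb bnd mult_left_le_one_le)
  from poly_bound_outside_interval[OF p(1) this, of "norm x / r"] x r
  show ?thesis using xb by (simp add: p(2))
qed

text \<open>The weight in \<open>u\<close> vanishes on the sphere of radius \<delta>, so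
  \<open>u\<close> restricted to a full chord of the ball is the modulus of a one-variable
  polynomial bounded by its maximum \<open>u z\<close>. The exponent \<open>10 * N\<close> is large
  enough to keep the maximizer away from the sphere.\<close>

lemma polynomial_small_of_small_on_dense:
  fixes P :: "'a::euclidean_space \<Rightarrow> real"
  assumes P: "polynomial_on_lines N P" and cont: "continuous_on UNIV P"
    and N: "N \<ge> 1" and \<delta>: "\<delta> > 0" and h: "2000 * real N * h \<le> \<delta>"
    and near: "\<And>x. norm x \<le> \<delta> / 2 \<Longrightarrow> \<exists>y. norm (y - x) \<le> h \<and> \<bar>P y\<bar> \<le> \<epsilon>"
    and x: "norm x \<le> \<delta> / 4"
  shows "\<bar>P x\<bar> \<le> 2 * (16 / 15) ^ (10 * N) * \<epsilon>"
proof -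
  define m where "m = 10 * N"
  define u where "u x = (\<delta>\<^sup>2 - (norm x)\<^sup>2) ^ m * \<bar>P x\<bar>" for x
  have "continuous_on (cball 0 \<delta>) u"
    unfolding u_def by (intro continuous_intros continuous_on_subset[OF cont]) auto
  then obtain z where z: "norm z \<le> \<delta>" and zmax: "\<And>x. norm x \<le> \<delta> \<Longrightarrow> u x \<le> u z"
    using continuous_attains_sup[of "cball 0 \<delta>" u] \<delta> by auto
  have sq: "(norm x)\<^sup>2 \<le> (c * \<delta>)\<^sup>2" if "norm x \<le> c * \<delta>" for x :: 'a and c
    using that by (intro power_mono) auto
  have A0: "u z \<ge> 0" unfolding u_def using sq[of z 1] z by simp
  have \<epsilon>: "\<epsilon> \<ge> 0" using near[of 0] \<delta> by force
  \<comment> \<open>The weight is at least \<open>(15 / 16 * \<delta>\<^sup>2) ^ m\<close> on the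
    ball of radius \<delta>/4. Comparison with its value at the origin yields the final factor
    \<open>(16 / 15) ^ m\<close>.\<close>
  define B where "B = u z / (15 / 16 * \<delta>\<^sup>2) ^ m"
  have B: "\<bar>P x\<bar> \<le> B" if "norm x \<le> \<delta> / 4" for x
  proof -
    have "(15 / 16 * \<delta>\<^sup>2) ^ m * \<bar>P x\<bar> \<le> (\<delta>\<^sup>2 - (norm x)\<^sup>2) ^ m * \<bar>P x\<bar>"
      using sq[of x "1/4"] that by (intro mult_right_mono power_mono) (auto simp: power_divide)
    also have "\<dots> \<le> u z" using zmax[of x] that \<delta> by (simp add: u_def)
    finally show ?thesis using \<delta> by (simp add: B_def field_simps)
  qed
  \<comment> \<open>Extrapolating from radius \<delta>/4 to at most \<delta> costs
    \<open>8 ^ N\<close>, while beyond \<delta>/2 the weight is smaller by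
    \<open>(4 / 5) ^ (10 * N)\<close>. As \<open>(4 / 5) ^ 10 * 8 < 1\<close>, a maximizer there
    would give \<open>u z < u z\<close>.\<close>
  have half: "norm z \<le> \<delta> / 2" if "u z > 0"
  proof (rule ccontr)
    assume far: "\<not> norm z \<le> \<delta> / 2"
    have B0: "B \<ge> 0" using A0 \<delta> by (simp add: B_def)
    have "\<bar>P z\<bar> \<le> B * (2 * (norm z / (\<delta> / 4))) ^ N"
      by (rule polynomial_on_lines_extrapolate[OF P _ B]) (use \<delta> far in auto)
    also have "\<dots> \<le> B * 8 ^ N"
      using z \<delta> by (intro mult_left_mono power_mono B0) (auto simp: field_simps)
    finally have Pz: "\<bar>P z\<bar> \<le> B * 8 ^ N" .
    have "(\<delta> / 2)\<^sup>2 \<le> (norm z)\<^sup>2" using far \<delta> by (intro power_mono) auto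
    then have "u z \<le> (3 / 4 * \<delta>\<^sup>2) ^ m * (B * 8 ^ N)"
      unfolding u_def using sq[of z 1] z Pz
      by (intro mult_mono power_mono) (auto simp: power_divide)
    also have "\<dots> = ((3 / 4 * \<delta>\<^sup>2) / (15 / 16 * \<delta>\<^sup>2)) ^ m * 8 ^ N * u z"
      by (simp only: B_def power_divide) simp
    also have "(3 / 4 * \<delta>\<^sup>2) / (15 / 16 * \<delta>\<^sup>2) = 4 / 5" using \<delta> by simp
    also have "(4 / 5 :: real) ^ m * 8 ^ N = ((4 / 5) ^ 10 * 8) ^ N"
      by (simp only: m_def power_mult power_mult_distrib)
    finally have "1 \<le> ((4 / 5) ^ 10 * 8 :: real) ^ N" using that by simp
    moreover have "((4 / 5) ^ 10 * 8 :: real) ^ N < 1"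
      by (rule power_less_one_iff[THEN iffD2]) (use N in \<open>auto simp: power_divide\<close>)
    ultimately show False by simp
  qed
  have "u z \<le> 2 * (\<delta>\<^sup>2) ^ m * \<epsilon>"
  proof (cases "u z > 0")
    case False
    then have "u z = 0" using A0 by simp
    also have "0 \<le> 2 * (\<delta>\<^sup>2) ^ m * \<epsilon>" using \<epsilon> by simp
    finally show ?thesis .
  next
    case True
    note half = half[OF True]
    obtain y where y: "norm (y - z) \<le> h" "\<bar>P y\<bar> \<le> \<epsilon>" using near[OF half] by blast
    define t\<^sub>1 where "t\<^sub>1 = norm (y - z)"
    have "2000 * t\<^sub>1 \<le> 2000 * (real N * h)"
      using y(1) N order_trans[OF norm_ge_zero y(1)] mult_right_mono[of 1 "real N" h]
      by (auto simp: t\<^sub>1_def)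
    with h have t1: "2000 * t\<^sub>1 \<le> \<delta>" by (simp add: mult.assoc)
    have "u y \<le> (\<delta>\<^sup>2) ^ m * \<epsilon>"
    proof -
      have "norm y \<le> norm z + t\<^sub>1" by (simp add: t\<^sub>1_def norm_triangle_sub)
      then have "norm y \<le> 1 * \<delta>" using half t1 \<delta> by simp
      from sq[OF this] show ?thesis
        unfolding u_def using y(2) by (intro mult_mono power_mono) auto
    qed
    moreover have "u z \<le> 2 * u y"
    proof (cases "y = z")
      case True
      then show ?thesis using A0 by simp
    next
      case False
      then have t1': "t\<^sub>1 > 0" by (simp add: t\<^sub>1_def)
      \<comment> \<open>On the line from \<open>z\<close> in direction \<open>e\<close>, the point
        \<open>z + t\<^sub>0 *\<^sub>R e\<close> is nearest to the origin. It is the midpoint of the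
        chord cut out by the ball of radius \<delta>, and \<open>L\<close> is half the length of
        that chord.\<close>
      define e where "e = (1 / t\<^sub>1) *\<^sub>R (y - z)"
      have ne: "e \<bullet> e = 1" using False by (simp add: e_def t\<^sub>1_def dot_square_norm power2_eq_square)
      define t\<^sub>0 where "t\<^sub>0 = - (z \<bullet> e)"
      define L where "L = sqrt (\<delta>\<^sup>2 - (norm z)\<^sup>2 + t\<^sub>0\<^sup>2)"
      have zz: "4 * (norm z)\<^sup>2 \<le> \<delta>\<^sup>2" using sq[of z "1/2"] half by (simp add: power_divide)
      have L2: "L\<^sup>2 = \<delta>\<^sup>2 - (norm z)\<^sup>2 + t\<^sub>0\<^sup>2" 
        using zz zero_le_power2[of t\<^sub>0] zero_le_power2[of "norm z"] unfolding L_def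
        by (intro real_sqrt_pow2) linarith
      have t0: "t\<^sub>0\<^sup>2 \<le> (norm z)\<^sup>2"
        using Cauchy_Schwarz_ineq[of z e] ne by (simp add: t\<^sub>0_def dot_square_norm)
      have "\<delta>\<^sup>2 > 0" using \<delta> by simp
      have "(17 / 20 * \<delta>)\<^sup>2 \<le> L\<^sup>2"
      proof -
        have "(17 / 20 * \<delta>)\<^sup>2 = 289 / 400 * \<delta>\<^sup>2" by (simp add: power_mult_distrib power_divide)
        with zz L2 \<open>\<delta>\<^sup>2 > 0\<close> zero_le_power2[of t\<^sub>0] show ?thesis by linarith
      qed
      moreover have L0: "L > 0"
        using zz \<open>\<delta>\<^sup>2 > 0\<close> zero_le_power2[of t\<^sub>0] unfolding L_def real_sqrt_gt_0_iff
        by linarith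
      ultimately have L\<delta>: "17 / 20 * \<delta> \<le> L" by (metis less_imp_le power2_le_imp_le)
      have "t\<^sub>0\<^sup>2 \<le> 36 / 100 * L\<^sup>2" using L2 zz t0 \<open>\<delta>\<^sup>2 > 0\<close> by linarith
      then have "(t\<^sub>0 / L)\<^sup>2 \<le> (6 / 10)\<^sup>2"
        using L0 by (simp add: power_divide pos_divide_le_eq)
      then have s0: "\<bar>t\<^sub>0 / L\<bar> \<le> 6 / 10" by (metis abs_le_square_iff abs_numeral abs_divide)
      have tL: "t\<^sub>1 / L \<le> 1 / 1700" using t1 L\<delta> L0 by (simp add: divide_le_eq)
      obtain p where p: "degree p \<le> N"
        "\<And>s. poly p s = P ((z + t\<^sub>0 *\<^sub>R e) + s *\<^sub>R (L *\<^sub>R e))"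
        using P unfolding polynomial_on_lines_def by metis
      \<comment> \<open>The weight along the chord is
        \<open>(L\<^sup>2 * (1 - s\<^sup>2)) ^ m\<close> in the parameter \<open>s\<close>, with the
        endpoints at -1 and 1. Hence \<open>q\<close> is the signed restriction of \<open>u\<close>,
        of degree at most \<open>2 * m + N = 21 * N\<close>.\<close>
      define q where "q = Polynomial.smult ((L\<^sup>2) ^ m) ([:1, 0, -1:] ^ m * p)"
      define \<gamma> where "\<gamma> s = (z + t\<^sub>0 *\<^sub>R e) + s *\<^sub>R (L *\<^sub>R e)" for s
      have \<gamma>: "\<delta>\<^sup>2 - (norm (\<gamma> s))\<^sup>2 = L\<^sup>2 * (1 - s\<^sup>2)" for s
      proof -
        have eq: "\<gamma> s = z + (t\<^sub>0 + s * L) *\<^sub>R e" by (simp add: \<gamma>_def scaleR_add_left)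
        have "(norm (z + r *\<^sub>R e))\<^sup>2 = (norm z)\<^sup>2 + 2 * r * (z \<bullet> e) + r\<^sup>2 * (e \<bullet> e)" for r
          unfolding power2_norm_eq_inner
          by (simp add: inner_add_left inner_add_right inner_commute power2_eq_square)
        from this[of "t\<^sub>0 + s * L", folded eq]
        ne L2 show ?thesis
          by (simp add: t\<^sub>0_def power2_eq_square algebra_simps)
      qed
      have qu: "\<bar>poly q s\<bar> = u (\<gamma> s)" if "\<bar>s\<bar> \<le> 1" for s
      proof -
        have "s\<^sup>2 \<le> 1" using that by (metis abs_le_square_iff abs_one one_power2)
        then have "0 \<le> (L\<^sup>2 * (1 - s\<^sup>2)) ^ m" by simp
        moreover have "poly q s = (L\<^sup>2 * (1 - s\<^sup>2)) ^ m * P (\<gamma> s)"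
          by (simp add: q_def p(2) \<gamma>_def power_mult_distrib power2_eq_square)
        ultimately show ?thesis unfolding u_def \<gamma> by (simp add: abs_mult)
      qed
      have "degree q \<le> 2 * m + N"
      proof -
        have "degree q \<le> degree ([:1, 0, -1:] ^ m * p :: real poly)"
          unfolding q_def by (rule degree_smult_le)
        also have "\<dots> \<le> degree ([:1, 0, -1::real:] ^ m) + degree p" by (rule degree_mult_le)
        also have "\<dots> \<le> 2 * m + N"
          by (intro add_mono p(1) order_trans[OF degree_power_le]) auto
        finally show ?thesis .
      qed
      moreover have "\<bar>poly q s\<bar> \<le> u z" if "\<bar>s\<bar> \<le> 1" for s
      proof -
        have "s\<^sup>2 \<le> 1" using that by (metis abs_le_square_iff abs_one one_power2)
        then have "(norm (\<gamma> s))\<^sup>2 \<le> \<delta>\<^sup>2" using \<gamma>[of s] by (smt (verit) mult_nonneg_nonneg zero_le_power2)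
        then have "norm (\<gamma> s) \<le> \<delta>" using \<delta> by (metis less_imp_le power2_le_imp_le)
        then show ?thesis using qu[OF that] zmax by simp
      qed
      \<comment> \<open>These are the chord parameters of \<open>z\<close> and \<open>y\<close>.
        Staying within 9/10 makes the interior Lipschitz estimate applicable.\<close>
      moreover have s1: "\<bar>- t\<^sub>0 / L\<bar> \<le> 9 / 10" "\<bar>(t\<^sub>1 - t\<^sub>0) / L\<bar> \<le> 9 / 10"
      proof -
        have "t\<^sub>1 / L > 0" using t1' L0 by (rule divide_pos_pos)
        with s0 tL show "\<bar>- t\<^sub>0 / L\<bar> \<le> 9 / 10" "\<bar>(t\<^sub>1 - t\<^sub>0) / L\<bar> \<le> 9 / 10"
          unfolding diff_divide_distrib minus_divide_left[symmetric] by linarith+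
      qed
      ultimately have "\<bar>\<bar>poly q (- t\<^sub>0 / L)\<bar> - \<bar>poly q ((t\<^sub>1 - t\<^sub>0) / L)\<bar>\<bar>
          \<le> 24 * real (2 * m + N) * u z * \<bar>- t\<^sub>0 / L - (t\<^sub>1 - t\<^sub>0) / L\<bar>"
        using N by (intro poly_lipschitz_interval) auto
      moreover have "\<bar>poly q (- t\<^sub>0 / L)\<bar> = u z"
      proof -
        have "\<gamma> (- t\<^sub>0 / L) = z" using L0 by (simp add: \<gamma>_def)
        then show ?thesis using qu[OF order_trans[OF s1(1)]] by simp
      qed
      moreover have "\<bar>poly q ((t\<^sub>1 - t\<^sub>0) / L)\<bar> = u y"
      proof -
        have "\<gamma> ((t\<^sub>1 - t\<^sub>0) / L) = z + t\<^sub>1 *\<^sub>R e"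
          using L0 by (simp add: \<gamma>_def scaleR_diff_left)
        also have "\<dots> = y" using t1' by (simp add: e_def)
        finally show ?thesis using qu[OF order_trans[OF s1(2)]] by simp
      qed
      moreover have "\<bar>- t\<^sub>0 / L - (t\<^sub>1 - t\<^sub>0) / L\<bar> = t\<^sub>1 / L"
        using L0 t1' by (simp add: field_simps)
      \<comment> \<open>Here 24 * 21 = 504, and \<open>t\<^sub>1 / L\<close> is at most 1 / (1700 N)
        because 2000 * 17/20 = 1700. Since 504/1700 < 1/2, at least half of the maximum survives at
        \<open>y\<close>.\<close>
      ultimately have "u z - u y \<le> 24 * real (2 * m + N) * u z * (t\<^sub>1 / L)" by simp
      also have "\<dots> = 504 * (real N * (t\<^sub>1 / L)) * u z" by (simp add: m_def)
      also have "\<dots> \<le> 504 * (1 / 1700) * u z"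
      proof (intro mult_right_mono mult_left_mono A0)
        have "2000 * (real N * t\<^sub>1) \<le> \<delta>"
          using h mult_left_mono[OF y(1), of "real N"] by (simp add: t\<^sub>1_def)
        then show "real N * (t\<^sub>1 / L) \<le> 1 / 1700" using L\<delta> L0 by (simp add: divide_le_eq)
      qed simp
      finally show ?thesis using A0 by simp
    qed
    ultimately show ?thesis by simp
  qed
  then have "B \<le> 2 * (\<delta>\<^sup>2) ^ m * \<epsilon> / (15 / 16 * \<delta>\<^sup>2) ^ m"
    unfolding B_def using \<delta> by (intro divide_right_mono) auto
  also have "\<dots> = 2 * (16 / 15) ^ m * \<epsilon>"
    using \<delta> by (simp add: field_simps)
  finally show ?thesis using B[OF x] by (simp add: m_def)
qed


section \<open>Local polynomial approximation of the kernel\<close>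

lemma polynomial_on_lines_const: "polynomial_on_lines 0 (\<lambda>_. c)"
  unfolding polynomial_on_lines_def by (intro allI exI[of _ "[:c:]"]) auto

lemma polynomial_on_lines_mono:
  "polynomial_on_lines M P \<Longrightarrow> M \<le> N \<Longrightarrow> polynomial_on_lines N P"
  unfolding polynomial_on_lines_def by (meson order_trans)

lemma polynomial_on_lines_add:
  assumes "polynomial_on_lines N P" "polynomial_on_lines N Q"
  shows "polynomial_on_lines N (\<lambda>x. P x + Q x)"
  unfolding polynomial_on_lines_def
proof (intro allI)
  fix a b
  from assms obtain p q where "degree p \<le> N" "degree q \<le> N"
    "\<And>t. poly p t = P (a + t *\<^sub>R b)" "\<And>t. poly q t = Q (a + t *\<^sub>R b)"
    unfolding polynomial_on_lines_def by metis
  then show "\<exists>r. degree r \<le> N \<and> (\<forall>t. poly r t = P (a + t *\<^sub>R b) + Q (a + t *\<^sub>R b))"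
    by (intro exI[of _ "p + q"]) (auto intro: degree_add_le)
qed

lemma polynomial_on_lines_mult:
  assumes "polynomial_on_lines M P" "polynomial_on_lines N Q"
  shows "polynomial_on_lines (M + N) (\<lambda>x. P x * Q x)"
  unfolding polynomial_on_lines_def
proof (intro allI)
  fix a b
  from assms obtain p q where "degree p \<le> M" "degree q \<le> N"
    "\<And>t. poly p t = P (a + t *\<^sub>R b)" "\<And>t. poly q t = Q (a + t *\<^sub>R b)"
    unfolding polynomial_on_lines_def by metis
  then show "\<exists>r. degree r \<le> M + N \<and> (\<forall>t. poly r t = P (a + t *\<^sub>R b) * Q (a + t *\<^sub>R b))"
    by (intro exI[of _ "p * q"]) (auto intro: order_trans[OF degree_mult_le] add_mono)
qed

lemma polynomial_on_lines_cmult: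
  "polynomial_on_lines N P \<Longrightarrow> polynomial_on_lines N (\<lambda>x. c * P x)"
  using polynomial_on_lines_mult[OF polynomial_on_lines_const] by fastforce

lemma polynomial_on_lines_power:
  assumes "polynomial_on_lines M P"
  shows "polynomial_on_lines (M * j) (\<lambda>x. P x ^ j)"
  by (induction j) (use polynomial_on_lines_const polynomial_on_lines_mult[OF assms] in auto)

lemma polynomial_on_lines_sum:
  assumes "\<And>i. i \<in> I \<Longrightarrow> polynomial_on_lines N (P i)"
  shows "polynomial_on_lines N (\<lambda>x. \<Sum>i\<in>I. P i x)"
  using assms
  by (induction I rule: infinite_finite_induct)
    (auto intro!: polynomial_on_lines_add polynomial_on_lines_mono[OF polynomial_on_lines_const])

lemma polynomial_on_lines_norm_sq:
  fixes w :: "'a::real_inner"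
  shows "polynomial_on_lines 2 (\<lambda>u. (2 * (u \<bullet> w) + u \<bullet> u) / \<rho>)"
  unfolding polynomial_on_lines_def
proof (intro allI)
  fix a b :: 'a
  show "\<exists>r. degree r \<le> 2 \<and> (\<forall>t. poly r t =
      (2 * ((a + t *\<^sub>R b) \<bullet> w) + (a + t *\<^sub>R b) \<bullet> (a + t *\<^sub>R b)) / \<rho>)"
    by (rule exI[of _ "[:(2 * (a \<bullet> w) + a \<bullet> a) / \<rho>, (2 * (b \<bullet> w) + 2 * (a \<bullet> b)) / \<rho>, (b \<bullet> b) / \<rho>:]"])
      (simp add: inner_add_left inner_add_right inner_commute add_divide_distrib algebra_simps)
qed

text \<open>Convergence of the series at 1/2 bounds the j-th coefficient by a constant times
  \<open>2 ^ j\<close>. The tail is then dominated by a geometric series of ratio at most 1/2, with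
  a constant independent of the degree.\<close>

lemma binomial_series_truncation:
  fixes a :: real
  obtains C where "C > 0"
    "\<And>n \<tau>. \<bar>\<tau>\<bar> \<le> 1 / 4 \<Longrightarrow>
       \<bar>(1 + \<tau>) powr a - (\<Sum>j\<le>n. (a gchoose j) * \<tau> ^ j)\<bar> \<le> C * (2 * \<bar>\<tau>\<bar>) ^ n"
proof -
  have "(\<lambda>j. (a gchoose j) * (1 / 2) ^ j) \<longlonglongrightarrow> 0"
    by (rule summable_LIMSEQ_zero[OF sums_summable[OF gen_binomial_real]]) simp
  then have "Bseq (\<lambda>j. (a gchoose j) * (1 / 2) ^ j)"
    using convergent_def convergent_imp_Bseq by blast
  then obtain K where K: "K > 0" "\<And>j. norm ((a gchoose j) * (1 / 2) ^ j) \<le> K"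
    by (auto elim: BseqE)
  have coeff_le: "\<bar>a gchoose j\<bar> \<le> K * 2 ^ j" for j
    using K(2)[of j] by (simp add: abs_mult power_divide divide_le_eq)
  have "\<bar>(1 + \<tau>) powr a - (\<Sum>j\<le>n. (a gchoose j) * \<tau> ^ j)\<bar> \<le> 2 * K * (2 * \<bar>\<tau>\<bar>) ^ n"
    if \<tau>: "\<bar>\<tau>\<bar> \<le> 1 / 4" for n \<tau>
  proof -
    let ?f = "\<lambda>j. (a gchoose j) * \<tau> ^ j"
    have "?f sums (1 + \<tau>) powr a" using \<tau> by (intro gen_binomial_real) simp
    then have "(\<lambda>j. ?f (j + Suc n)) sums ((1 + \<tau>) powr a - (\<Sum>j<Suc n. ?f j))"
      by (rule sums_split_initial_segment)
    then have tail: "(\<lambda>j. ?f (j + Suc n)) sums ((1 + \<tau>) powr a - (\<Sum>j\<le>n. ?f j))"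
      by (simp only: lessThan_Suc_atMost)
    have geo: "(\<lambda>j. K * (2 * \<bar>\<tau>\<bar>) ^ Suc n * (2 * \<bar>\<tau>\<bar>) ^ j) sums
        (K * (2 * \<bar>\<tau>\<bar>) ^ Suc n * (1 / (1 - 2 * \<bar>\<tau>\<bar>)))"
      using \<tau> by (intro sums_mult geometric_sums) simp
    have le: "norm (?f (j + Suc n)) \<le> K * (2 * \<bar>\<tau>\<bar>) ^ Suc n * (2 * \<bar>\<tau>\<bar>) ^ j" for j
    proof -
      have "norm (?f (j + Suc n)) \<le> (K * 2 ^ (j + Suc n)) * \<bar>\<tau>\<bar> ^ (j + Suc n)"
        unfolding real_norm_def abs_mult power_abs by (intro mult_right_mono coeff_le) simp
      then show ?thesis by (simp add: power_add power_mult_distrib mult_ac)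
    qed
    have "norm ((1 + \<tau>) powr a - (\<Sum>j\<le>n. ?f j)) \<le>
        K * (2 * \<bar>\<tau>\<bar>) ^ Suc n * (1 / (1 - 2 * \<bar>\<tau>\<bar>))"
      unfolding sums_unique[OF tail] sums_unique[OF geo]
      by (rule norm_suminf_le[OF le sums_summable[OF geo]])
    also have "\<dots> = K * (2 * \<bar>\<tau>\<bar>) ^ n * (2 * \<bar>\<tau>\<bar> / (1 - 2 * \<bar>\<tau>\<bar>))" by simp
    also have "\<dots> \<le> K * (2 * \<bar>\<tau>\<bar>) ^ n * 2"
      using \<tau> K(1) by (intro mult_left_mono) (auto simp: divide_le_eq)
    finally show ?thesis by simp
  qed
  with K(1) show ?thesis by (intro that[of "2 * K"]) auto
qed

text \<open>With \<open>\<tau> = (2 u \<bullet> (z - y) + |u|\<^sup>2) / |z - y|\<^sup>2\<close> the kernel is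
  \<open>|z - y| powr (- \<alpha>) * (1 + \<tau>) powr (- \<alpha> / 2)\<close>, and \<open>\<tau>\<close> is quadratic in \<open>u\<close>.\<close>

lemma f_kernel_polynomial_approximation:
  fixes \<alpha> :: real
  assumes "\<alpha> > 0"
  obtains C where "C > 0"
    "\<And>D R n (z :: real ^ 'd) y. D > 0 \<Longrightarrow> D \<le> norm (z - y) \<Longrightarrow> 0 \<le> R \<Longrightarrow> 12 * R \<le> D \<Longrightarrow>
       \<exists>P. polynomial_on_lines (2 * n) P \<and> continuous_on UNIV P \<and>
           (\<forall>u. norm u \<le> R \<longrightarrow>
             \<bar>f_kernel \<alpha> (z + u) y - P u\<bar> \<le> C * D powr (- \<alpha>) * (6 * R / D) ^ n)"
proof -
  obtain C where C: "C > 0" "\<And>n \<tau>. \<bar>\<tau>\<bar> \<le> 1 / 4 \<Longrightarrow>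
      \<bar>(1 + \<tau>) powr (- \<alpha> / 2) - (\<Sum>j\<le>n. ((- \<alpha> / 2) gchoose j) * \<tau> ^ j)\<bar> \<le> C * (2 * \<bar>\<tau>\<bar>) ^ n"
    using binomial_series_truncation[of "- \<alpha> / 2"] by metis
  have "\<exists>P. polynomial_on_lines (2 * n) P \<and> continuous_on UNIV P \<and>
        (\<forall>u. norm u \<le> R \<longrightarrow>
          \<bar>f_kernel \<alpha> (z + u) y - P u\<bar> \<le> C * D powr (- \<alpha>) * (6 * R / D) ^ n)"
    if D: "D > 0" and Dz: "D \<le> norm (z - y)" and R: "0 \<le> R" "12 * R \<le> D"
    for D R n and z y :: "real ^ 'd"
  proof -
    define w where "w = z - y"
    define \<tau> where "\<tau> u = (2 * (u \<bullet> w) + u \<bullet> u) / (w \<bullet> w)" for u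
    define P where
      "P u = norm w powr (- \<alpha>) * (\<Sum>j\<le>n. ((- \<alpha> / 2) gchoose j) * \<tau> u ^ j)" for u
    have w: "D \<le> norm w" using Dz by (simp add: w_def)
    with D have w0: "norm w > 0" by linarith
    have "polynomial_on_lines (2 * n) P"
      unfolding P_def \<tau>_def
      by (intro polynomial_on_lines_cmult polynomial_on_lines_sum
          polynomial_on_lines_mono[OF polynomial_on_lines_power[OF polynomial_on_lines_norm_sq]]) auto
    moreover have "continuous_on UNIV P"
      unfolding P_def \<tau>_def using w0 by (intro continuous_intros) auto
    moreover have "\<bar>f_kernel \<alpha> (z + u) y - P u\<bar> \<le> C * D powr (- \<alpha>) * (6 * R / D) ^ n"
      if u: "norm u \<le> R" for u
    proof -
      \<comment> \<open>From \<open>norm u \<le> R \<le> norm w\<close> the quadratic term costs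
        only one more \<open>R * norm w\<close>, which is the source of the 3 in
        \<open>3 * R / D\<close>.\<close>
      have "\<bar>2 * (u \<bullet> w) + u \<bullet> u\<bar> \<le> 2 * (norm u * norm w) + norm u * norm u"
        using Cauchy_Schwarz_ineq2[of u w] zero_le_power2[of "norm u"]
        unfolding dot_square_norm power2_eq_square by linarith
      also have "\<dots> \<le> 2 * (R * norm w) + R * norm w"
        using u R D w by (intro add_mono mult_left_mono mult_mono) auto
      finally have "\<bar>\<tau> u\<bar> \<le> 3 * R * norm w / (w \<bullet> w)"
        by (simp add: \<tau>_def abs_mult divide_right_mono)
      also have "\<dots> = 3 * R / norm w" using w0 by (simp add: dot_square_norm power2_eq_square)
      also have "\<dots> \<le> 3 * R / D" using w D R by (intro divide_left_mono mult_pos_pos w0) auto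
      finally have \<tau>: "\<bar>\<tau> u\<bar> \<le> 3 * R / D" .
      also have "3 * R / D \<le> 1 / 4" using R D by (simp add: divide_le_eq)
      finally have \<tau>4: "\<bar>\<tau> u\<bar> \<le> 1 / 4" .
      have "(norm (z + u - y))\<^sup>2 = (norm w)\<^sup>2 * (1 + \<tau> u)"
      proof -
        have eq: "z + u - y = w + u" by (simp add: w_def)
        have "(norm (z + u - y))\<^sup>2 = w \<bullet> w + (2 * (u \<bullet> w) + u \<bullet> u)"
          unfolding eq by (simp add: power2_norm_eq_inner inner_add_left inner_add_right inner_commute)
        moreover have "2 * (u \<bullet> w) + u \<bullet> u = (w \<bullet> w) * \<tau> u"
          using w0 by (simp add: \<tau>_def)
        ultimately show ?thesis by (simp add: power2_norm_eq_inner distrib_left)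
      qed
      moreover have "norm v powr (- \<alpha>) = (norm v)\<^sup>2 powr (- \<alpha> / 2)" for v :: "real ^ 'd"
        by (cases "v = 0") (simp_all add: powr_powr flip: powr_numeral)
      ultimately have "f_kernel \<alpha> (z + u) y = norm w powr (- \<alpha>) * (1 + \<tau> u) powr (- \<alpha> / 2)"
        using \<tau>4 by (simp add: f_kernel_def powr_mult)
      then have "\<bar>f_kernel \<alpha> (z + u) y - P u\<bar> = norm w powr (- \<alpha>) *
          \<bar>(1 + \<tau> u) powr (- \<alpha> / 2) - (\<Sum>j\<le>n. ((- \<alpha> / 2) gchoose j) * \<tau> u ^ j)\<bar>"
        by (simp add: P_def abs_mult flip: right_diff_distrib)
      also have "\<dots> \<le> D powr (- \<alpha>) * (C * (2 * \<bar>\<tau> u\<bar>) ^ n)"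
        using w D assms \<tau>4 by (intro mult_mono C(2) powr_mono2') auto
      also have "\<dots> \<le> D powr (- \<alpha>) * (C * (6 * R / D) ^ n)"
        using \<tau> C(1) by (intro mult_left_mono power_mono) auto
      finally show ?thesis by (simp add: mult_ac)
    qed
    ultimately show ?thesis by blast
  qed
  with C(1) show ?thesis using that by blast
qed

section \<open>Balls inside unions of moved cubes\<close>

text \<open>Contracting a cube towards one of its points by a suitable factor shrinks the inscribed
  ball to radius \<delta> and keeps it in the cube. The cubes share one side length, so the
  threshold \<open>s / 2\<close> serves all points of \<open>X\<close>.\<close>

lemma union_of_moved_cubes_inner_ball:
  fixes X :: "(real ^ 'd) set"
  assumes "union_of_moved_cubes X"
  obtains \<delta>\<^sub>0 where "\<delta>\<^sub>0 > 0"
    "\<And>x \<delta>. x \<in> X \<Longrightarrow> 0 < \<delta> \<Longrightarrow> \<delta> \<le> \<delta>\<^sub>0 \<Longrightarrow>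
       \<exists>z. ball z \<delta> \<subseteq> X \<and> norm (x - z) \<le> real CARD('d) * \<delta>"
proof -
  obtain Q M where Q: "is_cube Q" and rot: "\<And>R t. (R, t) \<in> M \<Longrightarrow> rotation_matrix R"
    and X: "X = (\<Union>(R, t)\<in>M. (\<lambda>z. R *v z + t) ` Q)"
    using assms unfolding union_of_moved_cubes_def by blast
  obtain a s where s: "s > 0" and Qs: "box a (a + s *\<^sub>R One) \<subseteq> Q" "Q \<subseteq> cbox a (a + s *\<^sub>R One)"
    using Q unfolding is_cube_def by (metis box_subset_cbox order_refl)
  have "\<exists>z. ball z \<delta> \<subseteq> X \<and> norm (x - z) \<le> real CARD('d) * \<delta>"
    if x: "x \<in> X" and \<delta>: "0 < \<delta>" "\<delta> \<le> s / 2" for x \<delta>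
  proof -
    obtain R t q where Rt: "(R, t) \<in> M" and q: "q \<in> Q" and xq: "x = R *v q + t"
      using x X by blast
    have orth: "orthogonal_matrix R" using rot[OF Rt] by (simp add: rotation_matrix_def)
    then have RRt: "R ** transpose R = Finite_Cartesian_Product.mat 1"
      and iso: "orthogonal_transformation ((*v) R)" "orthogonal_transformation ((*v) (transpose R))"
      by (simp_all add: orthogonal_matrix_def orthogonal_transformation_matrix orthogonal_matrix_transpose)
    define \<theta> where "\<theta> = 2 * \<delta> / s"
    have \<theta>: "0 < \<theta>" "\<theta> \<le> 1" using \<delta> s by (auto simp: \<theta>_def)
    define c where "c = a + (s / 2) *\<^sub>R One"
    define z where "z = q + \<theta> *\<^sub>R (c - q)"
    have qi: "a \<bullet> i \<le> q \<bullet> i" "q \<bullet> i \<le> a \<bullet> i + s" if "i \<in> Basis" for i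
      using q Qs(2) that by (auto simp: mem_box inner_add_left)
    have ci: "c \<bullet> i = a \<bullet> i + s / 2" if "i \<in> Basis" for i
      using that by (simp add: c_def inner_add_left)
    have cq: "\<bar>(c - q) \<bullet> i\<bar> \<le> s / 2" if "i \<in> Basis" for i
      using qi[OF that] ci[OF that] unfolding inner_diff_left by linarith
    have \<delta>\<theta>: "\<delta> = \<theta> * (s / 2)" using s by (simp add: \<theta>_def)
    \<comment> \<open>Each coordinate of \<open>z\<close> is a convex combination of those of
      \<open>q\<close> and the centre \<open>c\<close>, with weight \<theta> on \<open>c\<close>. It
      therefore keeps distance \<open>\<theta> * (s / 2) = \<delta>\<close> from both faces.\<close>
    have ball_Q: "ball z \<delta> \<subseteq> Q"
    proof
      fix p assume "p \<in> ball z \<delta>"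
      then have pz: "norm (p - z) < \<delta>" by (simp add: dist_norm norm_minus_commute)
      have "a \<bullet> i < p \<bullet> i \<and> p \<bullet> i < a \<bullet> i + s" if i: "i \<in> Basis" for i
      proof -
        have "\<bar>p \<bullet> i - z \<bullet> i\<bar> < \<delta>"
          using Basis_le_norm[OF i, of "p - z"] pz by (simp add: inner_diff_left)
        moreover have "z \<bullet> i = (1 - \<theta>) * (q \<bullet> i) + \<theta> * (a \<bullet> i) + \<delta>"
          by (simp add: z_def inner_add_left inner_diff_left ci[OF i] \<delta>\<theta> algebra_simps)
        moreover have "(1 - \<theta>) * (a \<bullet> i) \<le> (1 - \<theta>) * (q \<bullet> i)"
          "(1 - \<theta>) * (q \<bullet> i) \<le> (1 - \<theta>) * (a \<bullet> i + s)"
          using qi[OF i] \<theta> by (auto intro: mult_left_mono)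
        moreover have "(1 - \<theta>) * (a \<bullet> i) = a \<bullet> i - \<theta> * (a \<bullet> i)"
          "(1 - \<theta>) * (a \<bullet> i + s) = a \<bullet> i + s - \<theta> * (a \<bullet> i) - 2 * \<delta>"
          by (simp_all add: \<delta>\<theta> algebra_simps)
        ultimately show ?thesis unfolding abs_less_iff by linarith
      qed
      then show "p \<in> Q" using Qs(1) by (auto simp: mem_box inner_add_left)
    qed
    have "ball (R *v z + t) \<delta> \<subseteq> (\<lambda>z. R *v z + t) ` Q"
    proof
      fix p assume p: "p \<in> ball (R *v z + t) \<delta>"
      define p' where "p' = transpose R *v (p - t)"
      have pp: "R *v p' + t = p"
        unfolding p'_def matrix_vector_mul_assoc RRt by simp
      have "norm (z - p') = norm (R *v (z - p'))"
        using orthogonal_transformation_norm[OF iso(1)] by simp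
      also have "R *v (z - p') = R *v z + t - p"
        by (simp add: matrix_vector_mult_diff_distrib flip: pp)
      finally have "p' \<in> ball z \<delta>" using p by (simp add: dist_norm)
      with ball_Q pp show "p \<in> (\<lambda>z. R *v z + t) ` Q" by (metis image_eqI subsetD)
    qed
    also have "\<dots> \<subseteq> X" using Rt X by blast
    finally have 1: "ball (R *v z + t) \<delta> \<subseteq> X" .
    have "x - (R *v z + t) = R *v (q - z)"
      by (simp add: xq matrix_vector_mult_diff_distrib)
    then have "norm (x - (R *v z + t)) = norm (q - z)"
      using orthogonal_transformation_norm[OF iso(1)] by simp
    also have "\<dots> = \<theta> * norm (c - q)" using \<theta> by (simp add: z_def)
    also have "\<dots> \<le> \<theta> * (\<Sum>i\<in>Basis. \<bar>(c - q) \<bullet> i\<bar>)"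
      using \<theta> by (intro mult_left_mono norm_le_l1) auto
    also have "\<dots> \<le> \<theta> * (\<Sum>i\<in>(Basis :: (real ^ 'd) set). s / 2)"
      using \<theta> by (intro mult_left_mono sum_mono cq) auto
    also have "\<dots> = real CARD('d) * \<delta>" by (simp add: \<delta>\<theta>)
    finally show ?thesis using 1 by blast
  qed
  then show ?thesis using s by (intro that[of "s / 2"]) auto
qed


section \<open>Linear algebra of the cross approximation\<close>

text \<open>The step with pivot \<open>xs j\<close> annihilates that row. Later steps subtract
  multiples of remainders which already vanish there.\<close>

lemma cross_remainder_pivot_row:
  assumes "\<And>l. l < k \<Longrightarrow> cross_remainder f xs ys l (xs l) (ys l) \<noteq> 0" and "j < k"
  shows "cross_remainder f xs ys k (xs j) y = 0"
  using assms by (induction k arbitrary: y) (auto simp: less_Suc_eq)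

lemma cross_remainder_pivot_column:
  assumes "\<And>l. l < k \<Longrightarrow> cross_remainder f xs ys l (xs l) (ys l) \<noteq> 0" and "j < k"
  shows "cross_remainder f xs ys k x (ys j) = 0"
  using assms by (induction k arbitrary: x) (auto simp: less_Suc_eq)

text \<open>Summing the rank-one updates; at the pivots, where the last remainder vanishes, this
  becomes an LU factorization.\<close>

lemma cross_remainder_telescope:
  "f x y = cross_remainder f xs ys k x y + (\<Sum>l<k. cross_remainder f xs ys l x (ys l) *
     (cross_remainder f xs ys l (xs l) y / cross_remainder f xs ys l (xs l) (ys l)))"
  by (induction k) (auto simp: algebra_simps)

text \<open>The coefficients may depend on \<open>y\<close> but not on \<open>x\<close>. The
  induction keeps \<open>y\<close> arbitrary because the update also involves the remainder at
  \<open>ys k\<close>.\<close>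

lemma cross_remainder_combination:
  "\<exists>a. \<forall>x. cross_remainder f xs ys k x y = f x y - (\<Sum>i<k. a i * f x (ys i))"
proof (induction k arbitrary: y)
  case 0
  then show ?case by simp
next
  case (Suc k)
  obtain a where a: "\<And>x. cross_remainder f xs ys k x y = f x y - (\<Sum>i<k. a i * f x (ys i))"
    using Suc by blast
  obtain b where
    b: "\<And>x. cross_remainder f xs ys k x (ys k) = f x (ys k) - (\<Sum>i<k. b i * f x (ys i))"
    using Suc by blast
  define \<gamma> where "\<gamma> = cross_remainder f xs ys k (xs k) y / cross_remainder f xs ys k (xs k) (ys k)"
  have "cross_remainder f xs ys (Suc k) x y
      = f x y - (\<Sum>i<Suc k. (if i < k then a i - \<gamma> * b i else \<gamma>) * f x (ys i))" for x
  proof -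
    have "cross_remainder f xs ys (Suc k) x y
        = cross_remainder f xs ys k x y - \<gamma> * cross_remainder f xs ys k x (ys k)"
      by (simp add: \<gamma>_def)
    then show ?thesis
      by (simp add: a b algebra_simps sum_subtractf sum_distrib_left)
  qed
  then show ?case by (intro exI[of _ "\<lambda>i. if i < k then a i - \<gamma> * b i else \<gamma>"]) blast
qed

text \<open>The vanishing rows and columns make both factors of the telescoped sum triangular. The
  diagonal of \<open>L\<close> consists of the pivot values and that of \<open>U\<close> of
  ones.\<close>

lemma det_cross_matrix_nonzero:
  assumes piv: "\<And>l. l < k \<Longrightarrow> cross_remainder f xs ys l (xs l) (ys l) \<noteq> 0"
  shows "Determinant.det (cross_matrix f xs ys k) \<noteq> 0"
proof -
  define r where "r = cross_remainder f xs ys"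
  define L where "L = Matrix.mat k k (\<lambda>(j, l). r l (xs j) (ys l))"
  define U where "U = Matrix.mat k k (\<lambda>(l, i). r l (xs l) (ys i) / r l (xs l) (ys l))"
  have L: "L \<in> carrier_mat k k" and U: "U \<in> carrier_mat k k" by (simp_all add: L_def U_def)
  have "cross_matrix f xs ys k = L * U"
  proof (rule eq_matI)
    fix j i assume "j < dim_row (L * U)" "i < dim_col (L * U)"
    then have ji: "j < k" "i < k" by (simp_all add: L_def U_def)
    have "f (xs j) (ys i) = (\<Sum>l<k. r l (xs j) (ys l) * (r l (xs l) (ys i) / r l (xs l) (ys l)))"
      using cross_remainder_telescope[of f "xs j" "ys i" xs ys k]
        cross_remainder_pivot_row[of k f xs ys j "ys i"] piv ji(1) by (simp add: r_def)
    with ji show "cross_matrix f xs ys k $$ (j, i) = (L * U) $$ (j, i)"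
      by (simp add: cross_matrix_def L_def U_def scalar_prod_def atLeast0LessThan)
  qed (simp_all add: cross_matrix_def L_def U_def)
  then have "Determinant.det (cross_matrix f xs ys k) = Determinant.det L * Determinant.det U"
    by (simp add: Determinant.det_mult[OF L U])
  moreover have "Determinant.det L \<noteq> 0"
  proof -
    have "Determinant.det L = prod_list (diag_mat L)"
      by (rule det_lower_triangular[OF _ L])
        (auto simp: L_def r_def intro!: cross_remainder_pivot_row piv)
    also have "\<dots> \<noteq> 0"
      using piv by (auto simp: prod_list_zero_iff diag_mat_def L_def r_def)
    finally show ?thesis .
  qed
  moreover have "Determinant.det U \<noteq> 0"
  proof -
    have "upper_triangular U"
      by (auto simp: upper_triangular_def U_def r_def intro!: cross_remainder_pivot_column piv)
    then have "Determinant.det U = prod_list (diag_mat U)"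
      by (rule det_upper_triangular[OF _ U])
    also have "\<dots> \<noteq> 0"
      using piv by (auto simp: prod_list_zero_iff diag_mat_def U_def r_def)
    finally show ?thesis .
  qed
  ultimately show ?thesis by simp
qed

text \<open>Evaluating the combination at the pivots shows that its coefficients solve the linear
  system with matrix \<open>cross_matrix\<close> and right-hand side \<open>cross_column\<close>.
  Cramer's rule turns the determinant hypothesis into a bound on them.\<close>

lemma cross_remainder_bounded_combination:
  assumes piv: "\<And>l. l < k \<Longrightarrow> cross_remainder f xs ys l (xs l) (ys l) \<noteq> 0"
    and det: "\<And>i. i < k \<Longrightarrow>
      \<bar>Determinant.det (replace_col (cross_matrix f xs ys k) (cross_column f xs k y) i)\<bar>
      \<le> c * \<bar>Determinant.det (cross_matrix f xs ys k)\<bar>"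
  obtains a where "\<And>x. cross_remainder f xs ys k x y = f x y - (\<Sum>i<k. a i * f x (ys i))"
    "\<And>i. i < k \<Longrightarrow> \<bar>a i\<bar> \<le> c"
proof -
  obtain a where a: "\<And>x. cross_remainder f xs ys k x y = f x y - (\<Sum>i<k. a i * f x (ys i))"
    using cross_remainder_combination by metis
  let ?C = "cross_matrix f xs ys k"
  have C: "?C \<in> carrier_mat k k" by (simp add: cross_matrix_def)
  have Ca: "?C *\<^sub>v Matrix.vec k a = cross_column f xs k y"
  proof (rule eq_vecI)
    fix j assume "j < dim_vec (cross_column f xs k y)"
    then have j: "j < k" by (simp add: cross_column_def)
    then have "f (xs j) y = (\<Sum>i<k. a i * f (xs j) (ys i))"
      using a[of "xs j"] cross_remainder_pivot_row[of k f xs ys j y] piv by simp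
    with j show "(?C *\<^sub>v Matrix.vec k a) $ j = cross_column f xs k y $ j"
      by (simp add: cross_matrix_def cross_column_def scalar_prod_def atLeast0LessThan mult.commute)
  qed (simp add: cross_matrix_def cross_column_def)
  have "\<bar>a i\<bar> \<le> c" if i: "i < k" for i
  proof -
    have "\<bar>a i\<bar> * \<bar>Determinant.det ?C\<bar> \<le> c * \<bar>Determinant.det ?C\<bar>"
      using cramer_lemma_mat[OF C _ i, of "Matrix.vec k a"] det[OF i] i
      by (simp add: Ca flip: abs_mult)
    then show ?thesis using det_cross_matrix_nonzero[OF piv] by simp
  qed
  with a show ?thesis using that by blast
qed

section \<open>From zeros of the remainder to the final estimate\<close>

text \<open>Both the oversampling result and the extrapolation to \<open>x\<close> lose only factors that are
  exponential in the degree, so that an approximation error decaying fast enough compensates them.\<close>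

lemma approximable_bound_of_dense_zeros:
  fixes X :: "'a::euclidean_space set"
  assumes P: "polynomial_on_lines (2 * n) P" "continuous_on UNIV P"
    and err: "\<And>u. norm u \<le> (d + 1) * \<delta> \<Longrightarrow> \<bar>g (z + u) - P u\<bar> \<le> \<epsilon>"
    and n: "n \<ge> 1" and d: "d \<ge> 1" and \<delta>: "\<delta> > 0" and h: "4000 * real n * h \<le> \<delta>"
    and zeros: "\<And>v. v \<in> X \<Longrightarrow> \<exists>w. norm (w - v) \<le> h \<and> g w = 0"
    and z: "ball z \<delta> \<subseteq> X" "norm (x - z) \<le> d * \<delta>"
  shows "\<bar>g x\<bar> \<le> 3 * ((8 * (d + 1))\<^sup>2 * (16 / 15) ^ 20) ^ n * \<epsilon>"
proof -
  have d\<delta>: "\<delta> \<le> d * \<delta>" using d \<delta> by simp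
  have "z \<in> X" using z(1) \<delta> by auto
  then have h0: "h \<ge> 0" using zeros order_trans[OF norm_ge_zero] by blast
  have "4000 * h \<le> 4000 * (real n * h)" using n h0 mult_right_mono[of 1 "real n" h] by simp
  with h have h4: "4000 * h \<le> \<delta>" by (simp add: mult.assoc)
  have \<epsilon>: "\<epsilon> \<ge> 0" using err[of 0] d\<delta> \<delta> by (auto simp: algebra_simps)
  define B where "B = 2 * (16 / 15) ^ (10 * (2 * n)) * \<epsilon>"
  have small: "\<bar>P u\<bar> \<le> B" if "norm u \<le> \<delta> / 4" for u
    unfolding B_def
  proof (rule polynomial_small_of_small_on_dense[OF P _ \<delta> _ _ that])
    show "2000 * real (2 * n) * h \<le> \<delta>" using h by simp
    fix v :: 'a assume v: "norm v \<le> \<delta> / 2"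
    then have "z + v \<in> X" using z(1) \<delta> by (auto simp: dist_norm)
    then obtain w where w: "norm (w - (z + v)) \<le> h" "g w = 0" using zeros by blast
    \<comment> \<open>A zero near \<open>z + v\<close> may leave the ball of radius \<delta>, which
      is why the approximation is required up to radius \<open>(d + 1) * \<delta>\<close>.\<close>
    have "norm (w - z) \<le> norm v + norm (w - (z + v))"
      using norm_triangle_ineq[of v "w - (z + v)"] by simp
    also have "\<dots> \<le> (d + 1) * \<delta>" using v w(1) h4 d\<delta> \<delta> h0 unfolding distrib_right by linarith
    finally have "\<bar>P (w - z)\<bar> \<le> \<epsilon>" using err[of "w - z"] w(2) by simp
    with w(1) show "\<exists>y. norm (y - v) \<le> h \<and> \<bar>P y\<bar> \<le> \<epsilon>"
      by (intro exI[of _ "w - z"]) (simp add: algebra_simps)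
  qed (use n in simp)
  have B0: "B \<ge> 0" using \<epsilon> by (simp add: B_def)
  have "\<bar>P (x - z)\<bar> \<le> B * (8 * (d + 1)) ^ (2 * n)"
  proof (cases "norm (x - z) \<le> \<delta> / 4")
    case True
    have "B * 1 \<le> B * (8 * (d + 1)) ^ (2 * n)"
      using d by (intro mult_left_mono B0 one_le_power) simp
    with small[OF True] show ?thesis by simp
  next
    case False
    then have "\<bar>P (x - z)\<bar> \<le> B * (2 * (norm (x - z) / (\<delta> / 4))) ^ (2 * n)"
      using \<delta> by (intro polynomial_on_lines_extrapolate[OF P(1) _ small]) auto
    also have "\<dots> \<le> B * (8 * (d + 1)) ^ (2 * n)"
      using z(2) \<delta> by (intro mult_left_mono power_mono B0) (auto simp: field_simps)
    finally show ?thesis .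
  qed
  also have "\<dots> = 2 * ((8 * (d + 1))\<^sup>2 * (16 / 15) ^ 20) ^ n * \<epsilon>"
  proof -
    have "(16 / 15 :: real) ^ (10 * (2 * n)) = ((16 / 15) ^ 20) ^ n"
      unfolding power_mult[symmetric] by simp
    moreover have "(8 * (d + 1)) ^ (2 * n) = ((8 * (d + 1))\<^sup>2) ^ n" by (rule power_mult)
    ultimately show ?thesis by (simp only: B_def power_mult_distrib mult_ac)
  qed
  finally have "\<bar>P (x - z)\<bar> \<le> 2 * ((8 * (d + 1))\<^sup>2 * (16 / 15) ^ 20) ^ n * \<epsilon>" .
  moreover have "\<bar>g x - P (x - z)\<bar> \<le> \<epsilon>"
    using err[of "x - z"] z(2) \<delta> by (simp add: algebra_simps)
  \<comment> \<open>The approximation error at \<open>x\<close> is absorbed into the same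
    exponential factor, raising the constant from 2 to 3.\<close>
  moreover have "1 * \<epsilon> \<le> ((8 * (d + 1))\<^sup>2 * (16 / 15) ^ 20) ^ n * \<epsilon>"
  proof (intro mult_right_mono one_le_power \<epsilon>)
    have "1 * 1 \<le> (8 * (d + 1))\<^sup>2 * (16 / 15 :: real) ^ 20"
      using d by (intro mult_mono one_le_power) auto
    then show "1 \<le> (8 * (d + 1))\<^sup>2 * (16 / 15 :: real) ^ 20" by simp
  qed
  ultimately show ?thesis by linarith
qed

theorem theorem6:
  fixes \<alpha> \<beta> \<eta> c\<^sub>M :: real and X Y :: "(real ^ 'd) set"
  assumes "\<alpha> > 0" and "\<eta> > 0" and "\<beta> > 0"
    and "X \<noteq> {}" and "Y \<noteq> {}" and "bounded X" and "bounded Y"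
    and "max (diameter X) (diameter Y) \<le> \<eta> * setdist X Y"
    and "union_of_moved_cubes X"
    and "c\<^sub>M > 1"
  shows "\<exists>c lam. c > 0 \<and> 0 < lam \<and> lam < 1 \<and>
    (\<forall>(k::nat) xs ys.
       admissible_pivots (f_kernel \<alpha>) X Y xs ys k \<longrightarrow>
       (\<forall>i<k. \<forall>y\<in>Y.
          \<bar>Determinant.det (replace_col (cross_matrix (f_kernel \<alpha>) xs ys k)
              (cross_column (f_kernel \<alpha>) xs k y) i)\<bar>
          \<le> c\<^sub>M * \<bar>Determinant.det (cross_matrix (f_kernel \<alpha>) xs ys k)\<bar>) \<longrightarrow>
       (\<forall>x\<in>X. \<forall>y\<in>Y.
          \<bar>cross_remainder (f_kernel \<alpha>) xs ys k x y\<bar>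
          \<le> c * (c\<^sub>M * real k + 1) * lam powr (1 / fill_distance (xs ` {..<k}) X)))"
proof -
  define d where "d = real CARD('d)"
  have d: "d \<ge> 1" by (simp add: d_def Suc_leI)
  obtain \<delta>\<^sub>0 where \<delta>\<^sub>0: "\<delta>\<^sub>0 > 0"
    "\<And>x \<delta>. x \<in> X \<Longrightarrow> 0 < \<delta> \<Longrightarrow> \<delta> \<le> \<delta>\<^sub>0 \<Longrightarrow> \<exists>z. ball z \<delta> \<subseteq> X \<and> norm (x - z) \<le> d * \<delta>"
    unfolding d_def using union_of_moved_cubes_inner_ball[OF \<open>union_of_moved_cubes X\<close>] by metis
  define D where "D = setdist X Y"
  \<comment> \<open>\<open>X\<close> contains a ball, so its diameter is positive and the
    admissibility condition separates \<open>X\<close> from \<open>Y\<close>.\<close>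
  have D: "D > 0"
  proof -
    obtain x where "x \<in> X" using \<open>X \<noteq> {}\<close> by blast
    then obtain z where "ball z \<delta>\<^sub>0 \<subseteq> X" using \<delta>\<^sub>0 by blast
    then have "diameter (ball z \<delta>\<^sub>0) \<le> diameter X"
      using \<open>bounded X\<close> by (rule diameter_subset)
    with \<delta>\<^sub>0(1) have "0 < diameter X" by simp
    then have "0 < \<eta> * D" using assms(8) by (simp add: D_def)
    with \<open>\<eta> > 0\<close> show ?thesis by (simp add: zero_less_mult_iff)
  qed
  have dist_ge: "D \<le> norm (x - y)" if "x \<in> X" "y \<in> Y" for x y
    using setdist_le_dist[OF that] by (simp add: D_def dist_norm)
  obtain C where C: "C > 0"
    "\<And>D R n (z :: real ^ 'd) y. D > 0 \<Longrightarrow> D \<le> norm (z - y) \<Longrightarrow> 0 \<le> R \<Longrightarrow> 12 * R \<le> D \<Longrightarrow>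
       \<exists>P. polynomial_on_lines (2 * n) P \<and> continuous_on UNIV P \<and>
           (\<forall>u. norm u \<le> R \<longrightarrow>
             \<bar>f_kernel \<alpha> (z + u) y - P u\<bar> \<le> C * D powr (- \<alpha>) * (6 * R / D) ^ n)"
    using f_kernel_polynomial_approximation[OF \<open>\<alpha> > 0\<close>] by metis
  define E where "E = (8 * (d + 1))\<^sup>2 * (16 / 15) ^ 20"
  have E: "E \<ge> 1"
  proof -
    have "1 * 1 \<le> (8 * (d + 1))\<^sup>2 * (16 / 15 :: real) ^ 20"
      using d by (intro mult_mono one_le_power) auto
    then show ?thesis by (simp add: E_def)
  qed
  \<comment> \<open>The second bound gives \<open>12 * E * R \<le> D\<close>, so the approximation
    rate \<open>6 * R / D\<close> still leaves 1/2 after multiplication by the extrapolation cost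
    \<open>E\<close>.\<close>
  define \<delta> where "\<delta> = min \<delta>\<^sub>0 (D / (12 * E * (d + 1)))"
  have \<delta>: "\<delta> > 0" "\<delta> \<le> \<delta>\<^sub>0" using \<delta>\<^sub>0(1) D E d by (auto simp: \<delta>_def)
  define R where "R = (d + 1) * \<delta>"
  have R: "0 \<le> R" "12 * E * R \<le> D"
  proof -
    have "\<delta> \<le> D / (12 * E * (d + 1))" by (simp add: \<delta>_def)
    moreover have "12 * E * (d + 1) > 0" using E d by simp
    ultimately have "\<delta> * (12 * E * (d + 1)) \<le> D" by (simp only: pos_le_divide_eq)
    then show "12 * E * R \<le> D" by (simp only: R_def mult_ac)
  qed (use d \<delta> in \<open>simp add: R_def\<close>)
  have R12: "12 * R \<le> D" using R E mult_right_mono[of 1 E R] by simp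
  \<comment> \<open>The degree parameter below is about \<delta> / (4000 h) and each unit of it
    gains a factor 1/2.\<close>
  define lam :: real where "lam = 2 powr (- (\<delta> / 4000))"
  have lam_powr: "lam powr t = 2 powr (- (\<delta> / 4000 * t))" for t
    by (simp add: lam_def powr_powr)
  define c where "c = (6 * C + 2) * D powr (- \<alpha>)"
  have "\<bar>cross_remainder (f_kernel \<alpha>) xs ys k x y\<bar>
      \<le> c * (c\<^sub>M * real k + 1) * lam powr (1 / fill_distance (xs ` {..<k}) X)"
    if adm: "admissible_pivots (f_kernel \<alpha>) X Y xs ys k"
      and det: "\<And>i y. i < k \<Longrightarrow> y \<in> Y \<Longrightarrow>
        \<bar>Determinant.det (replace_col (cross_matrix (f_kernel \<alpha>) xs ys k)
            (cross_column (f_kernel \<alpha>) xs k y) i)\<bar>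
        \<le> c\<^sub>M * \<bar>Determinant.det (cross_matrix (f_kernel \<alpha>) xs ys k)\<bar>"
      and x: "x \<in> X" and y: "y \<in> Y" for k xs ys x y
  proof -
    define g where "g v = cross_remainder (f_kernel \<alpha>) xs ys k v y" for v
    define h where "h = fill_distance (xs ` {..<k}) X"
    define K where "K = c\<^sub>M * real k + 1"
    have K: "K \<ge> 1" using \<open>c\<^sub>M > 1\<close> by (simp add: K_def)
    have piv: "cross_remainder (f_kernel \<alpha>) xs ys l (xs l) (ys l) \<noteq> 0"
      and ys: "ys l \<in> Y" if "l < k" for l
      using adm that by (auto simp: admissible_pivots_def)
    obtain a where g: "\<And>v. g v = f_kernel \<alpha> v y - (\<Sum>i<k. a i * f_kernel \<alpha> v (ys i))"
      and a: "\<And>i. i < k \<Longrightarrow> \<bar>a i\<bar> \<le> c\<^sub>M"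
      using cross_remainder_bounded_combination[OF piv det[OF _ y]] unfolding g_def by metis
    \<comment> \<open>Used twice: for the trivial bound on the remainder and for passing from kernel
      approximations to an approximation of the remainder.\<close>
    have comb: "\<bar>p - (\<Sum>i<k. a i * q i)\<bar> \<le> K * b"
      if "\<bar>p\<bar> \<le> b" "\<And>i. i < k \<Longrightarrow> \<bar>q i\<bar> \<le> b" for p b and q :: "nat \<Rightarrow> real"
    proof -
      have "\<bar>\<Sum>i<k. a i * q i\<bar> \<le> (\<Sum>i<k. \<bar>a i * q i\<bar>)" by (rule sum_abs)
      also have "\<dots> \<le> (\<Sum>i<k. c\<^sub>M * b)"
        unfolding abs_mult using a that \<open>c\<^sub>M > 1\<close> by (intro sum_mono mult_mono) auto
      finally show ?thesis using that(1) by (simp add: K_def algebra_simps)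
    qed
    have "\<bar>g x\<bar> \<le> c * K * lam powr (1 / h)"
    \<comment> \<open>For a coarse fill distance \<open>lam powr (1 / h)\<close> is at least 1/2 and
      the trivial bound suffices. This case includes k = 0, where \<open>h = 0\<close> and
      \<open>1 / h = 0\<close> by convention.\<close>
    proof (cases "1 / h \<le> 4000 / \<delta>")
      case True
      have "\<bar>f_kernel \<alpha> x v\<bar> \<le> D powr (- \<alpha>)" if "v \<in> Y" for v
        unfolding f_kernel_def using dist_ge[OF x that] D \<open>\<alpha> > 0\<close> by (simp add: powr_mono2')
      then have "\<bar>g x\<bar> \<le> K * D powr (- \<alpha>)"
        unfolding g using y ys by (intro comb) auto
      also have "\<dots> = 2 * D powr (- \<alpha>) * K * (1 / 2)" by simp
      also have "\<dots> \<le> c * K * lam powr (1 / h)"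
      proof (intro mult_mono)
        show "2 * D powr (- \<alpha>) \<le> c" using C(1) by (simp add: c_def distrib_right)
        have "\<delta> / 4000 * (1 / h) \<le> \<delta> / 4000 * (4000 / \<delta>)"
          using True \<delta> by (intro mult_left_mono) auto
        also have "\<dots> = 1" using \<delta> by simp
        finally have "(2::real) powr (- 1) \<le> 2 powr (- (\<delta> / 4000 * (1 / h)))"
          by (intro powr_mono) auto
        then show "1 / 2 \<le> lam powr (1 / h)" by (simp add: lam_powr powr_minus_divide)
      qed (use C(1) K in \<open>auto simp: c_def\<close>)
      finally show ?thesis .
    next
      case False
      have h: "h > 0"
      proof (rule ccontr)
        assume "\<not> h > 0"
        then have "1 / h \<le> 0" by (simp add: divide_nonneg_nonpos)
        also have "0 \<le> 4000 / \<delta>" using \<delta> by simp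
        finally show False using False by simp
      qed
      define s where "s = \<delta> / (4000 * h)"
      have s: "s > 1" using False h \<delta> by (simp add: s_def field_simps)
      \<comment> \<open>Rounding down preserves the density condition
        \<open>4000 * real n * h \<le> \<delta>\<close>, and \<open>s > 1\<close> ensures a positive
        degree.\<close>
      define n where "n = nat \<lfloor>s\<rfloor>"
      have n: "n \<ge> 1" "real n \<le> s" "s \<le> real n + 1"
        using s by (auto simp: n_def le_nat_floor)
      have zeros: "\<exists>w. norm (w - v) \<le> h \<and> g w = 0" if v: "v \<in> X" for v
      proof -
        let ?S = "xs ` {..<k}"
        have "?S \<noteq> {}" using h by (auto simp: h_def fill_distance_def infdist_def \<open>X \<noteq> {}\<close>)
        obtain w where w: "w \<in> ?S" "infdist v ?S = dist v w"
          using infdist_attains_inf[OF finite_imp_closed \<open>?S \<noteq> {}\<close>] by blast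
        \<comment> \<open>Boundedness of \<open>X\<close> lets the supremum defining
          \<open>h\<close> dominate each individual distance.\<close>
        have "bdd_above ((\<lambda>v. infdist v ?S) ` X)"
        proof -
          obtain e where e: "\<And>v. v \<in> X \<Longrightarrow> dist w v \<le> e"
            using \<open>bounded X\<close> unfolding bounded_any_center[where a = w] by blast
          show ?thesis
            by (rule bdd_aboveI2[where M = e])
              (metis dist_commute e infdist_le order_trans w(1))
        qed
        then have "infdist v ?S \<le> h"
          unfolding h_def fill_distance_def using v by (intro cSUP_upper)
        moreover have "g w = 0"
          using w(1) piv by (auto simp: g_def intro: cross_remainder_pivot_row)
        ultimately show ?thesis using w(2) by (auto simp: dist_norm norm_minus_commute)
      qed
      obtain z where z: "ball z \<delta> \<subseteq> X" "norm (x - z) \<le> d * \<delta>" using \<delta>\<^sub>0(2)[OF x \<delta>] by blast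
      have "z \<in> X" using z(1) \<delta>(1) by auto
      define b where "b = C * D powr (- \<alpha>) * (6 * R / D) ^ n"
      have "\<forall>v\<in>Y. \<exists>P. polynomial_on_lines (2 * n) P \<and> continuous_on UNIV P \<and>
           (\<forall>u. norm u \<le> R \<longrightarrow> \<bar>f_kernel \<alpha> (z + u) v - P u\<bar> \<le> b)"
        unfolding b_def using C(2)[OF D dist_ge[OF \<open>z \<in> X\<close>] R(1) R12] by blast
      then obtain P where P: "\<And>v. v \<in> Y \<Longrightarrow> polynomial_on_lines (2 * n) (P v)"
        "\<And>v. v \<in> Y \<Longrightarrow> continuous_on UNIV (P v)"
        "\<And>v u. v \<in> Y \<Longrightarrow> norm u \<le> R \<Longrightarrow> \<bar>f_kernel \<alpha> (z + u) v - P v u\<bar> \<le> b"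
        by metis
      \<comment> \<open>The local approximations of the kernels are combined with the same
        coefficients as the kernels themselves in \<open>g\<close>.\<close>
      define p where "p u = P y u + (\<Sum>i<k. (- a i) * P (ys i) u)" for u
      have "\<bar>g x\<bar> \<le> 3 * ((8 * (d + 1))\<^sup>2 * (16 / 15) ^ 20) ^ n * (K * b)"
      proof (rule approximable_bound_of_dense_zeros[OF _ _ _ n(1) d \<delta>(1) _ zeros z])
        show "polynomial_on_lines (2 * n) p"
          unfolding p_def using y ys
          by (intro polynomial_on_lines_add polynomial_on_lines_sum polynomial_on_lines_cmult P) auto
        show "continuous_on UNIV p"
          unfolding p_def using y ys by (intro continuous_intros P) auto
        show "4000 * real n * h \<le> \<delta>" using n(2) h by (simp add: s_def field_simps)
        fix u :: "real ^ 'd" assume "norm u \<le> (d + 1) * \<delta>"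
        then have u: "norm u \<le> R" by (simp add: R_def)
        have "g (z + u) - p u = (f_kernel \<alpha> (z + u) y - P y u)
            - (\<Sum>i<k. a i * (f_kernel \<alpha> (z + u) (ys i) - P (ys i) u))"
          by (simp add: g p_def right_diff_distrib sum_subtractf sum_negf)
        also have "\<bar>\<dots>\<bar> \<le> K * b" using P(3) u y ys by (intro comb) auto
        finally show "\<bar>g (z + u) - p u\<bar> \<le> K * b" .
      qed
      also have "\<dots> = 3 * C * D powr (- \<alpha>) * K * (E * (6 * R / D)) ^ n"
        by (simp only: E_def b_def power_mult_distrib mult_ac)
      also have "\<dots> \<le> 3 * C * D powr (- \<alpha>) * K * (2 * lam powr (1 / h))"
      proof (intro mult_left_mono)
        have "(E * (6 * R / D)) ^ n \<le> (1 / 2) ^ n"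
          using E R D by (intro power_mono) (auto simp: field_simps)
        also have "\<dots> = 2 powr (- real n)" by (simp add: powr_minus_divide powr_realpow power_divide)
        \<comment> \<open>Rounding \<open>s\<close> down to \<open>n\<close> costs at most one
          factor 2, which turns 3 * C into the 6 * C of \<open>c\<close>.\<close>
        also have "\<dots> \<le> 2 powr (1 - s)" using n(3) by (intro powr_mono) auto
        also have "\<dots> = 2 * lam powr (1 / h)"
          by (simp add: lam_powr s_def powr_diff powr_minus_divide)
        finally show "(E * (6 * R / D)) ^ n \<le> 2 * lam powr (1 / h)" .
      qed (use C(1) K in auto)
      also have "\<dots> = 6 * C * D powr (- \<alpha>) * K * lam powr (1 / h)" by simp
      also have "\<dots> \<le> c * K * lam powr (1 / h)"
        using K by (intro mult_right_mono) (auto simp: c_def distrib_right)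
      finally show ?thesis .
    qed
    then show ?thesis by (simp add: g_def h_def K_def)
  qed
  moreover have "c > 0" using C(1) D by (simp add: c_def)
  moreover have "0 < lam" by (simp add: lam_def)
  moreover have "lam < 1" using \<delta>(1) by (simp add: lam_def powr_less_one)
  ultimately show ?thesis by blast
qed

end
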